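(* $D(K_3\,\Box\,K_5,2)\le 38/13$.
   Context: Graphs are finite and simple. For a graph $G$ and a positive integer $k$, a (fractional) $k$-coloring of $G$ is an assignment to every vertex $v$ of real numbers $f_1(v),\dots,f_k(v)\ge 0$ with $\sum_{j=1}^k f_j(v)=1$ ($f_j(v)$ is the usage of color $j$ at $v$). The defect of $v$ is $\mathrm{df}(v)=\sum_{w\in N(v)}\sum_{j=1}^k\min(f_j(v),f_j(w))$, where $N(v)$ is the set of neighbors of $v$. The defect of the coloring is $\max_v \mathrm{df}(v)$, and the minimum defect $D(G,k)$ is the minimum of this quantity over all $k$-colorings of $G$. $G\,\Box\,H$ denotes the Cartesian product: its vertex set is $V(G)\times V(H)$, and $(u_1,u_2)$, $(v_1,v_2)$ are adjacent if $u_1v_1\in E(G)$ and $u_2=v_2$, or $u_1=v_1$ and $u_2v_2\in E(H)$. $K_s$ is the complete graph on $s$ vertices. *)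

theory Defs
  imports "HOL-Analysis.Analysis" "Graph_Theory.Kuratowski"
begin

text \<open>
  A finite simple graph is a \<^locale>\<open>pair_graph\<close>: a finite vertex set with an irreflexive symmetric
  arc relation.
\<close>

definition nbrs :: "'a pair_pre_digraph \<Rightarrow> 'a \<Rightarrow> 'a set" where
  "nbrs G v = {w. (v, w) \<in> parcs G}"

definition cart_prod ::
  "'a pair_pre_digraph \<Rightarrow> 'b pair_pre_digraph \<Rightarrow> ('a \<times> 'b) pair_pre_digraph" (infixr \<open>\<box>\<close> 70) where
  "G \<box> H = \<lparr> pverts = pverts G \<times> pverts H,
     parcs = {((u1, u2), (v1, v2)). (u1, u2) \<in> pverts G \<times> pverts H \<and> (v1, v2) \<in> pverts G \<times> pverts H \<and>
       ((u1, v1) \<in> parcs G \<and> u2 = v2 \<or> u1 = v1 \<and> (u2, v2) \<in> parcs H)} \<rparr>"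

lemma pair_graph_cart_prod:
  assumes "pair_graph G" "pair_graph H"
  shows "pair_graph (G \<box> H)"
proof -
  interpret G: pair_graph G by fact
  interpret H: pair_graph H by fact
  have "parcs (G \<box> H) \<subseteq> (pverts G \<times> pverts H) \<times> (pverts G \<times> pverts H)"
    by (auto simp: cart_prod_def)
  moreover have "finite (pverts G \<times> pverts H)"
    using G.pair_finite_verts H.pair_finite_verts by simp
  ultimately have "finite (parcs (G \<box> H))"
    by (meson finite_SigmaI finite_subset)
  moreover have "sym (parcs (G \<box> H))"
    by (auto simp: cart_prod_def sym_def dest: G.arcs_symmetric H.arcs_symmetric)
  ultimately show ?thesis
    using G.pair_finite_verts H.pair_finite_verts
    by unfold_locales
      (auto simp: cart_prod_def symmetric_def dest: G.no_loops' H.no_loops')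
qed

text \<open>\<open>f v j\<close> is the usage of color \<open>j\<close> at \<open>v\<close>; the colors are \<open>1, \<dots>, k\<close>.\<close>

definition frac_coloring :: "'a pair_pre_digraph \<Rightarrow> nat \<Rightarrow> ('a \<Rightarrow> nat \<Rightarrow> real) \<Rightarrow> bool" where
  "frac_coloring G k f \<longleftrightarrow>
     (\<forall>v\<in>pverts G. (\<forall>j\<in>{1..k}. 0 \<le> f v j) \<and> (\<Sum>j=1..k. f v j) = 1)"

definition vertex_defect ::
  "'a pair_pre_digraph \<Rightarrow> nat \<Rightarrow> ('a \<Rightarrow> nat \<Rightarrow> real) \<Rightarrow> 'a \<Rightarrow> real" where
  "vertex_defect G k f v = (\<Sum>w\<in>nbrs G v. \<Sum>j=1..k. min (f v j) (f w j))"

definition defect :: "'a pair_pre_digraph \<Rightarrow> nat \<Rightarrow> ('a \<Rightarrow> nat \<Rightarrow> real) \<Rightarrow> real" where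
  "defect G k f = Max (vertex_defect G k f ` pverts G)"

text \<open>
  The minimum is attained for every finite graph with at least one vertex and every \<open>k \<ge> 1\<close>; see
  \<open>min_defect_attained\<close> and \<open>min_defect_le\<close> below.
\<close>

definition min_defect :: "'a pair_pre_digraph \<Rightarrow> nat \<Rightarrow> real" where
  "min_defect G k = (LEAST d. \<exists>f. frac_coloring G k f \<and> d = defect G k f)"

lemma continuous_on_Max_image:
  fixes g :: "'i \<Rightarrow> 'c::topological_space \<Rightarrow> real"
  assumes "finite A" "A \<noteq> {}" "\<And>v. v \<in> A \<Longrightarrow> continuous_on S (g v)"
  shows "continuous_on S (\<lambda>x. Max ((\<lambda>v. g v x) ` A))"
  using assms
proof (induction A rule: finite_ne_induct)
  case (insert a A)
  then have "(\<lambda>x. Max ((\<lambda>v. g v x) ` insert a A)) = (\<lambda>x. max (g a x) (Max ((\<lambda>v. g v x) ` A)))"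
    by auto
  then show ?case
    using insert by (auto intro!: continuous_on_max)
qed auto

lemma continuous_on_usage: "continuous_on S (\<lambda>f :: 'a \<Rightarrow> nat \<Rightarrow> real. f v j)"
proof -
  have "continuous_on UNIV (\<lambda>f :: 'a \<Rightarrow> nat \<Rightarrow> real. f v j)"
    by (rule continuous_on_compose2[OF continuous_on_product_coordinates
          continuous_on_product_coordinates]) auto
  then show ?thesis
    by (rule continuous_on_subset) auto
qed

lemma ex_min_defect:
  assumes G: "pair_graph G" and ne: "pverts G \<noteq> {}" and k: "1 \<le> k"
  shows "\<exists>f. frac_coloring G k f \<and> (\<forall>g. frac_coloring G k g \<longrightarrow> defect G k f \<le> defect G k g)"
proof -
  interpret pair_graph G by (fact G)
  have fin: "finite (pverts G)" by (fact pair_finite_verts)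
  define B :: "'a \<Rightarrow> nat \<Rightarrow> real set" where
    "B v j = (if v \<in> pverts G \<and> j \<in> {1..k} then {0..1} else {0})" for v j
  define S where "S = PiE UNIV (\<lambda>v. PiE UNIV (B v)) \<inter> {f. \<forall>v\<in>pverts G. (\<Sum>j=1..k. f v j) = 1}"
  have "compact (PiE UNIV (B v))" for v
    using compactin_PiE[of "\<lambda>_. euclidean :: real topology" UNIV "B v"]
    by (auto simp: B_def euclidean_product_topology)
  then have "compact (PiE UNIV (\<lambda>v. PiE UNIV (B v)))"
    using compactin_PiE[of "\<lambda>_. euclidean :: (nat \<Rightarrow> real) topology" UNIV "\<lambda>v. PiE UNIV (B v)"]
    by (auto simp: euclidean_product_topology)
  moreover have "closed {f :: 'a \<Rightarrow> nat \<Rightarrow> real. \<forall>v\<in>pverts G. (\<Sum>j=1..k. f v j) = 1}"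
    unfolding Ball_def
    by (intro closed_Collect_all closed_Collect_imp closed_Collect_eq continuous_on_sum
        continuous_on_usage continuous_on_const) auto
  ultimately have comp: "compact S"
    unfolding S_def by (rule compact_Int_closed)
  have S_col: "frac_coloring G k f" if "f \<in> S" for f
  proof -
    have "f v j \<in> B v j" for v j
      using that by (auto simp: S_def PiE_iff)
    then have "0 \<le> f v j" for v j
      by (metis (full_types) B_def atLeastAtMost_iff order_refl singletonD)
    then show ?thesis
      using that by (auto simp: S_def frac_coloring_def)
  qed
  have cont: "continuous_on S (defect G k)"
    unfolding defect_def vertex_defect_def
    by (intro continuous_on_Max_image fin ne continuous_on_sum continuous_on_min continuous_on_usage)
  have normalize: "\<exists>h\<in>S. defect G k h = defect G k g" if g: "frac_coloring G k g" for g
  proof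
    define h where "h v j = (if v \<in> pverts G \<and> j \<in> {1..k} then g v j else 0)" for v j
    have nb: "w \<in> pverts G" if "w \<in> nbrs G v" for v w
      using that by (auto simp: nbrs_def dest: in_arcsD2)
    have "vertex_defect G k h v = vertex_defect G k g v" if "v \<in> pverts G" for v
      unfolding vertex_defect_def using that nb by (intro sum.cong refl) (auto simp: h_def)
    then show "defect G k h = defect G k g"
      unfolding defect_def by (metis (no_types, lifting) image_cong)
    have "h v j \<in> B v j" for v j
    proof (cases "v \<in> pverts G \<and> j \<in> {1..k}")
      case True
      then have "g v j \<le> (\<Sum>j=1..k. g v j)"
        using g by (intro member_le_sum) (auto simp: frac_coloring_def)
      with True g show ?thesis
        by (auto simp: h_def B_def frac_coloring_def)
    qed (auto simp: h_def B_def)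
    moreover have "(\<Sum>j=1..k. h v j) = 1" if "v \<in> pverts G" for v
    proof -
      have "(\<Sum>j=1..k. h v j) = (\<Sum>j=1..k. g v j)"
        using that by (intro sum.cong) (auto simp: h_def)
      with g that show ?thesis by (simp add: frac_coloring_def)
    qed
    ultimately show "h \<in> S"
      by (auto simp: S_def PiE_iff)
  qed
  have "frac_coloring G k (\<lambda>v j. if j = 1 then 1 else 0)"
    using k by (simp add: frac_coloring_def)
  then have "S \<noteq> {}"
    using normalize by blast
  then obtain f where "f \<in> S" "\<And>h. h \<in> S \<Longrightarrow> defect G k f \<le> defect G k h"
    using continuous_attains_inf[OF comp _ cont] by blast
  then show ?thesis
    using S_col normalize by metis
qed

lemma min_defect_attained:
  assumes "pair_graph G" "pverts G \<noteq> {}" "1 \<le> k"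
  shows "\<exists>f. frac_coloring G k f \<and> min_defect G k = defect G k f"
proof -
  obtain f where "frac_coloring G k f" "\<And>g. frac_coloring G k g \<Longrightarrow> defect G k f \<le> defect G k g"
    using ex_min_defect[OF assms] by blast
  then have "frac_coloring G k f \<and> min_defect G k = defect G k f"
    unfolding min_defect_def by (intro conjI Least_equality) auto
  then show ?thesis by blast
qed

lemma min_defect_le:
  assumes "pair_graph G" "pverts G \<noteq> {}" "1 \<le> k" "frac_coloring G k f"
  shows "min_defect G k \<le> defect G k f"
proof -
  obtain h where "frac_coloring G k h" "\<And>g. frac_coloring G k g \<Longrightarrow> defect G k h \<le> defect G k g"
    using ex_min_defect[OF assms(1-3)] by blast
  moreover from this have "min_defect G k = defect G k h"
    unfolding min_defect_def by (intro Least_equality) auto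
  ultimately show ?thesis
    using assms(4) by simp
qed

end

theory Submission
  imports Defs
begin

text \<open>
  A coloring with two colors is a choice of one number \<open>x v \<in> [0, 1]\<close> for each vertex, the usage of
  the first color, and an edge \<open>v w\<close> costs each of its ends
  \<open>min (x v) (x w) + min (1 - x v) (1 - x w) = 1 - \<bar>x v - x w\<bar>\<close>.
  In the product of complete graphs on \<open>m\<close> and \<open>n\<close> vertices the coloring is an \<open>m \<times> n\<close> matrix, in
  which an entry is adjacent to the other entries of its row and of its column. The defect of
  an entry is therefore \<open>m + n - 2\<close> minus its total distance to the entries of its row and column;
  \<open>min_defect_complete_prod_le\<close> turns any matrix into an upper bound on the minimum defect in this way.

  For \<open>m = 3\<close>, \<open>n = 5\<close> it remains to find a matrix in which each total distance is at least
  \<open>6 - 38/13 = 40/13\<close>. Consider the matrices of the form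
  \<open>a 1 0 1 0\<close> / \<open>0 1 1 b c\<close> / \<open>0 b c 1 1\<close> with \<open>c \<le> b\<close>, in which most differences are \<open>0\<close> or \<open>1\<close>.
  The matrix is unchanged when the last two rows are swapped together with the second and fourth and
  the third and fifth columns, so only the first two rows matter. The total distances that bind are
  \<^item> \<open>2 + 2a\<close> at the entry \<open>a\<close>,
  \<^item> \<open>4 - a - b\<close> at the ones in the first row,
  \<^item> \<open>2 + a + b + c\<close> at the zero in the second row,
  \<^item> \<open>4 - 2b - c\<close> at the first one in the second row and at the entry \<open>b\<close>, and
  \<^item> \<open>3 + b - 2c\<close> at the entry \<open>c\<close>.
  These five are equal exactly when \<open>a = b + c\<close>, \<open>3a + b = 2\<close> and \<open>b + 4c = 1\<close>, that is, for
  \<open>a = 7/13\<close>, \<open>b = 5/13\<close>, \<open>c = 2/13\<close>, and then their common value is \<open>40/13\<close>. The other entries have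
  total distance \<open>3 + a + c = 48/13\<close> and \<open>5 - b - 2c = 56/13\<close>.
\<close>

lemma sum_two_colors: "(\<Sum>j=1..2. g j) = g 1 + g (2::nat)" for g :: "nat \<Rightarrow> real"
  by (simp add: numeral_2_eq_2)

definition two_coloring :: "('a \<Rightarrow> real) \<Rightarrow> 'a \<Rightarrow> nat \<Rightarrow> real" where
  "two_coloring x v j = (if j = 1 then x v else 1 - x v)"

lemma frac_coloring_two_coloring:
  assumes "\<And>v. v \<in> pverts G \<Longrightarrow> x v \<in> {0..1}"
  shows "frac_coloring G 2 (two_coloring x)"
  unfolding frac_coloring_def sum_two_colors
  using assms by (auto simp: two_coloring_def)

lemma vertex_defect_two_coloring:
  "vertex_defect G 2 (two_coloring x) v = (\<Sum>w\<in>nbrs G v. 1 - \<bar>x v - x w\<bar>)"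
  unfolding vertex_defect_def sum_two_colors
  by (intro sum.cong refl) (auto simp: two_coloring_def)

lemma nbrs_complete_prod:
  assumes G: "K\<^bsub>m\<^esub> (with_proj G)" and H: "K\<^bsub>n\<^esub> (with_proj H)"
    and "u \<in> pverts G" "w \<in> pverts H"
  shows "nbrs (G \<box> H) (u, w) =
    (\<lambda>u'. (u', w)) ` (pverts G - {u}) \<union> (\<lambda>w'. (u, w')) ` (pverts H - {w})"
  using assms by (auto simp: complete_digraph_pair_def nbrs_def cart_prod_def)

lemma sum_nbrs_complete_prod:
  fixes h :: "'a \<times> 'b \<Rightarrow> real"
  assumes G: "K\<^bsub>m\<^esub> (with_proj G)" and H: "K\<^bsub>n\<^esub> (with_proj H)"
    and u: "u \<in> pverts G" and w: "w \<in> pverts H"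
  shows "(\<Sum>v\<in>nbrs (G \<box> H) (u, w). h v) =
    (\<Sum>u'\<in>pverts G. h (u', w)) + (\<Sum>w'\<in>pverts H. h (u, w')) - 2 * h (u, w)"
proof -
  have fin: "finite (pverts G)" "finite (pverts H)"
    using G H by (auto simp: complete_digraph_pair_def)
  have "(\<Sum>v\<in>nbrs (G \<box> H) (u, w). h v) =
      sum h ((\<lambda>u'. (u', w)) ` (pverts G - {u})) + sum h ((\<lambda>w'. (u, w')) ` (pverts H - {w}))"
    unfolding nbrs_complete_prod[OF assms] using fin by (intro sum.union_disjoint) auto
  also have "\<dots> = (\<Sum>u'\<in>pverts G - {u}. h (u', w)) + (\<Sum>w'\<in>pverts H - {w}. h (u, w'))"
    by (simp add: sum.reindex inj_on_def)
  also have "\<dots> = ((\<Sum>u'\<in>pverts G. h (u', w)) - h (u, w)) + ((\<Sum>w'\<in>pverts H. h (u, w')) - h (u, w))"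
    using fin u w by (simp add: sum_diff1)
  finally show ?thesis by simp
qed

text \<open>
  Numbering the vertices of the factors makes the matrix \<open>M\<close> a two-coloring of the product. Its
  distance sums may run over the whole row and column because the entry itself contributes \<open>0\<close>.
\<close>

lemma min_defect_complete_prod_le:
  fixes M :: "nat \<Rightarrow> nat \<Rightarrow> real"
  assumes G: "K\<^bsub>m\<^esub> (with_proj G)" and H: "K\<^bsub>n\<^esub> (with_proj H)" and pos: "0 < m" "0 < n"
    and unit: "\<And>i j. i < m \<Longrightarrow> j < n \<Longrightarrow> M i j \<in> {0..1}"
    and far: "\<And>i j. i < m \<Longrightarrow> j < n \<Longrightarrow>
      real m + real n - 2 - d \<le> (\<Sum>i'<m. \<bar>M i j - M i' j\<bar>) + (\<Sum>j'<n. \<bar>M i j - M i j'\<bar>)"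
  shows "min_defect (G \<box> H) 2 \<le> d"
proof -
  have fin: "finite (pverts G)" "finite (pverts H)"
    and card: "card (pverts G) = m" "card (pverts H) = n"
    using G H by (auto simp: complete_digraph_pair_def)
  have prod: "pair_graph (G \<box> H)"
    using G H by (intro pair_graph_cart_prod pair_graphI_complete)
  have verts: "pverts (G \<box> H) = pverts G \<times> pverts H"
    by (simp add: cart_prod_def)
  have ne: "pverts (G \<box> H) \<noteq> {}"
    using card pos by (auto simp: verts)
  obtain p where p: "bij_betw p (pverts G) {..<m}"
    using ex_bij_betw_finite_nat[OF fin(1)] by (auto simp: card atLeast0LessThan)
  obtain q where q: "bij_betw q (pverts H) {..<n}"
    using ex_bij_betw_finite_nat[OF fin(2)] by (auto simp: card atLeast0LessThan)
  define x where "x = (\<lambda>(u, w). M (p u) (q w))"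
  have p_less: "p u < m" if "u \<in> pverts G" for u
    using bij_betwE[OF p] that by auto
  have q_less: "q w < n" if "w \<in> pverts H" for w
    using bij_betwE[OF q] that by auto
  have col: "frac_coloring (G \<box> H) 2 (two_coloring x)"
  proof (rule frac_coloring_two_coloring)
    fix v assume "v \<in> pverts (G \<box> H)"
    then show "x v \<in> {0..1}"
      using unit p_less q_less by (cases v) (simp add: verts x_def)
  qed
  have "vertex_defect (G \<box> H) 2 (two_coloring x) (u, w) \<le> d"
    if u: "u \<in> pverts G" and w: "w \<in> pverts H" for u w
  proof -
    have "(\<Sum>u'\<in>pverts G. 1 - \<bar>x (u, w) - x (u', w)\<bar>) =
        (\<Sum>i'<m. 1 - \<bar>M (p u) (q w) - M i' (q w)\<bar>)"
      using sum.reindex_bij_betw[OF p, of "\<lambda>i'. 1 - \<bar>M (p u) (q w) - M i' (q w)\<bar>"]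
      by (simp add: x_def)
    moreover have "(\<Sum>w'\<in>pverts H. 1 - \<bar>x (u, w) - x (u, w')\<bar>) =
        (\<Sum>j'<n. 1 - \<bar>M (p u) (q w) - M (p u) j'\<bar>)"
      using sum.reindex_bij_betw[OF q, of "\<lambda>j'. 1 - \<bar>M (p u) (q w) - M (p u) j'\<bar>"]
      by (simp add: x_def)
    ultimately have "vertex_defect (G \<box> H) 2 (two_coloring x) (u, w) =
        (\<Sum>i'<m. 1 - \<bar>M (p u) (q w) - M i' (q w)\<bar>) +
        (\<Sum>j'<n. 1 - \<bar>M (p u) (q w) - M (p u) j'\<bar>) - 2"
      unfolding vertex_defect_two_coloring sum_nbrs_complete_prod[OF G H u w] by simp
    then show ?thesis
      using far[OF p_less[OF u] q_less[OF w]] by (simp add: sum_subtractf)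
  qed
  then have "defect (G \<box> H) 2 (two_coloring x) \<le> d"
    unfolding defect_def using fin ne by (subst Max_le_iff) (auto simp: verts)
  with min_defect_le[OF prod ne _ col] show ?thesis by simp
qed

theorem lemma10:
  fixes G :: "'a pair_pre_digraph" and H :: "'b pair_pre_digraph"
  assumes "K\<^bsub>3\<^esub> (with_proj G)" and "K\<^bsub>5\<^esub> (with_proj H)"
  shows "min_defect (G \<box> H) 2 \<le> 38 / 13"
proof -
  define M :: "nat \<Rightarrow> nat \<Rightarrow> real" where
    "M i j = [[7, 13,  0, 13,  0],
              [0, 13, 13,  5,  2],
              [0,  5,  2, 13, 13]] ! i ! j / 13" for i j
  have rows: "i = 0 \<or> i = 1 \<or> i = 2" if "i < 3" for i :: nat
    using that by auto
  have columns: "j = 0 \<or> j = 1 \<or> j = 2 \<or> j = 3 \<or> j = 4" if "j < 5" for j :: nat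
    using that by auto
  have row_sum: "(\<Sum>i<3. g i) = g 0 + g 1 + g (2::nat)" for g :: "nat \<Rightarrow> real"
    by (simp add: eval_nat_numeral)
  have column_sum: "(\<Sum>j<5. g j) = g 0 + g 1 + g 2 + g 3 + g (4::nat)" for g :: "nat \<Rightarrow> real"
    by (simp add: eval_nat_numeral)
  show ?thesis
  proof (rule min_defect_complete_prod_le[OF assms, where M = M])
    fix i j :: nat
    assume ij: "i < 3" "j < 5"
    show "M i j \<in> {0..1}"
      using rows[OF ij(1)] columns[OF ij(2)] by (elim disjE) (simp_all add: M_def)
    show "real 3 + real 5 - 2 - 38 / 13 \<le> (\<Sum>i'<3. \<bar>M i j - M i' j\<bar>) + (\<Sum>j'<5. \<bar>M i j - M i j'\<bar>)"
      unfolding row_sum column_sum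
      using rows[OF ij(1)] columns[OF ij(2)] by (elim disjE) (simp_all add: M_def)
  qed simp_all
qed

end
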